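(* Let $a<b$ be real numbers, let $f:[a,b]\to\mathbb{R}$ be a smooth function, and let $p \ge 1$ be a fixed integer. For each integer $N > p$ let $f_N(n) = f\!\left(a + n\,\frac{b-a}{N-1}\right)$, $n = 0,1,\dots,N-1$, be the $N$ equidistant sampled points of $f$ on $[a,b]$, and for $p \le n \le N-1$ define $$\hat f_{N,p}(n) = f_N(n-1) + \Delta f_N(n-1) + \Delta^2 f_N(n-1) + \cdots + \Delta^{p-1} f_N(n-1).$$ Then: (1) $\hat f_{N,p}$ is an order $p$ linear prediction: there are real coefficients $a_1,\dots,a_p$, depending only on $p$, such that $\hat f_{N,p}(n) = \sum_{k=1}^{p} a_k f_N(n-k)$ for all $N>p$ and all $p \le n \le N-1$. (2) $\hat f_{N,p}$ approximates the sampled points with any precision as $N$ increases: for every $\varepsilon > 0$ there is $N_0 > p$ such that for all $N \ge N_0$ $$\frac{1}{N}\sum_{n=p}^{N-1}\bigl(f_N(n) - \hat f_{N,p}(n)\bigr)^2 \le \varepsilon .$$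
   Context: For a finite sequence $g(0),\dots,g(N-1)$ of real numbers and integers $k\ge 0$ and $m$ with $k \le m \le N-1$, $\Delta^k$ denotes the order $k$ (backward) difference operator $$\Delta^k g(m) = \sum_{i=0}^{k} (-1)^i \binom{k}{i}\, g(m-i),$$ so $\Delta^0 g = g$ and $\Delta = \Delta^1$. The approximation error is measured in the mean-square sense. *)

theory Defs
  imports "HOL-Analysis.Analysis"
begin

(* Infinite differentiability on S, with derivatives taken relative to S: on a closed interval
   they are one-sided at the end points, and values of f outside S are irrelevant.
   D k is the k-th derivative of f. *)
definition smooth_on :: "real set \<Rightarrow> (real \<Rightarrow> real) \<Rightarrow> bool" where
  "smooth_on S f \<longleftrightarrow>
     (\<exists>D :: nat \<Rightarrow> real \<Rightarrow> real. D 0 = f \<and>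
        (\<forall>k. \<forall>x\<in>S. (D k has_real_derivative D (Suc k) x) (at x within S)))"

(* Only meaningful for k \<le> m; otherwise the subtraction m - i is truncated. *)
definition bdiff :: "nat \<Rightarrow> (nat \<Rightarrow> real) \<Rightarrow> nat \<Rightarrow> real" where
  "bdiff k g m = (\<Sum>i=0..k. (-1) ^ i * real (k choose i) * g (m - i))"

(* Only meaningful for N \<ge> 2 and n < N. *)
definition sample :: "real \<Rightarrow> real \<Rightarrow> (real \<Rightarrow> real) \<Rightarrow> nat \<Rightarrow> nat \<Rightarrow> real" where
  "sample a b f N n = f (a + real n * ((b - a) / (real N - 1)))"

(* Only meaningful for 1 \<le> p \<le> n. *)
definition predictor :: "nat \<Rightarrow> (nat \<Rightarrow> real) \<Rightarrow> nat \<Rightarrow> real" where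
  "predictor p g n = (\<Sum>j=0..p-1. bdiff j g (n - 1))"

end

theory Submission
  imports Defs "HOL-Real_Asymp.Real_Asymp"
begin

text \<open>Pascal's rule telescopes the prediction error at \<open>n\<close> into the single difference of order \<open>p\<close>
  at \<open>n\<close>. Both claims follow: the coefficients of the predictor are the signed binomials
  \<open>- (-1)^k * (p choose k)\<close>, and the error is at most \<open>2^(p-1)\<close> times the largest increment of
  consecutive samples, which tends to zero by uniform continuity of \<open>f\<close>.\<close>

lemma bdiff_0: "bdiff 0 g m = g m"
  by (simp add: bdiff_def)

text \<open>Pascal's rule splits \<open>Suc k choose Suc i\<close> into two binomials of upper index
  \<open>k\<close>. The part with \<open>k choose i\<close> is the difference at
  \<open>m - 1\<close>, since \<open>m - Suc i = m - 1 - i\<close> also for truncated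
  subtraction.\<close>

lemma bdiff_Suc: "bdiff (Suc k) g m = bdiff k g m - bdiff k g (m - 1)"
proof -
  have "bdiff (Suc k) g m
      = g m + (\<Sum>i\<le>k. (-1) ^ Suc i * real (Suc k choose Suc i) * g (m - Suc i))"
    by (simp add: bdiff_def atLeast0AtMost sum.atMost_Suc_shift del: sum.atMost_Suc binomial_Suc_Suc)
  also have "\<dots> = (g m + (\<Sum>i\<le>k. (-1) ^ Suc i * real (k choose Suc i) * g (m - Suc i)))
                 - bdiff k g (m - 1)"
    by (simp add: bdiff_def atLeast0AtMost algebra_simps sum.distrib sum_negf sum_subtractf)
  also have "g m + (\<Sum>i\<le>k. (-1) ^ Suc i * real (k choose Suc i) * g (m - Suc i))
           = (\<Sum>i\<le>Suc k. (-1) ^ i * real (k choose i) * g (m - i))"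
    by (simp add: sum.atMost_Suc_shift del: sum.atMost_Suc)
  \<comment> \<open>The extra term \<open>i = Suc k\<close> vanishes because
    \<open>k choose Suc k = 0\<close>.\<close>
  also have "\<dots> = bdiff k g m"
    by (simp add: bdiff_def atLeast0AtMost)
  finally show ?thesis .
qed

lemma prediction_error:
  assumes "p \<ge> 1"
  shows "g n - predictor p g n = bdiff p g n"
proof -
  have "g n - (\<Sum>j<q. bdiff j g (n - 1)) = bdiff q g n" for q
    by (induction q) (simp_all add: bdiff_0 bdiff_Suc)
  \<comment> \<open>Here \<open>p \<ge> 1\<close> enters: for \<open>p = 0\<close> the truncated
    \<open>p-1\<close> would leave the index 0 in the range.\<close>
  moreover have "{0..p-1} = {..<p}"
    using assms by auto
  ultimately show ?thesis
    by (simp add: predictor_def)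
qed

text \<open>The term \<open>i = 0\<close> of \<open>bdiff p g n\<close> is \<open>g n\<close>
  itself, so it cancels in the identity for the prediction error and only earlier values
  remain.\<close>

lemma predictor_linear:
  assumes "p \<ge> 1"
  shows "predictor p g n = (\<Sum>k=1..p. - ((-1) ^ k * real (p choose k)) * g (n - k))"
proof -
  have "bdiff p g n = g n + (\<Sum>k=1..p. (-1) ^ k * real (p choose k) * g (n - k))"
    by (simp add: bdiff_def sum.atLeast_Suc_atMost)
  then show ?thesis
    using prediction_error[OF assms, of g n] by (simp add: sum_negf)
qed

text \<open>For \<open>i = 0\<close> the hypothesis says \<open>0 \<le> d\<close>, by truncated subtraction.\<close>

lemma abs_bdiff_le:
  assumes "\<And>i. i \<le> n \<Longrightarrow> \<bar>g i - g (i - 1)\<bar> \<le> d"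
  shows "\<bar>bdiff (Suc k) g n\<bar> \<le> 2 ^ k * d"
  using assms
proof (induction k arbitrary: n)
  case 0
  then show ?case by (simp add: bdiff_0 bdiff_Suc)
next
  case (Suc k)
  \<comment> \<open>The hypothesis covers all indices up to \<open>n\<close>, hence passes to
    \<open>n - 1\<close>. The triangle inequality then doubles the bound with each order.\<close>
  have "\<bar>bdiff (Suc k) g n\<bar> \<le> 2 ^ k * d" "\<bar>bdiff (Suc k) g (n - 1)\<bar> \<le> 2 ^ k * d"
    using Suc by auto
  then show ?case
    by (simp add: bdiff_Suc[of "Suc k"])
qed

lemma smooth_on_imp_continuous_on: "smooth_on S f \<Longrightarrow> continuous_on S f"
  unfolding smooth_on_def by (metis DERIV_continuous_on)

lemma sample_increment_eventually_small:
  assumes "a < b" and cont: "continuous_on {a..b} f" and "e > 0"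
  shows "\<forall>\<^sub>F N in sequentially. \<forall>n<N. \<bar>sample a b f N n - sample a b f N (n - 1)\<bar> \<le> e"
proof -
  obtain \<delta> where "\<delta> > 0"
    and \<delta>: "\<And>x y. x \<in> {a..b} \<Longrightarrow> y \<in> {a..b} \<Longrightarrow> dist y x < \<delta> \<Longrightarrow> dist (f y) (f x) < e"
    using compact_uniformly_continuous[OF cont compact_Icc] \<open>e > 0\<close>
    unfolding uniformly_continuous_on_def by metis
  have "(\<lambda>N. (b - a) / (real N - 1)) \<longlonglongrightarrow> 0"
    by real_asymp
  then have "\<forall>\<^sub>F N in sequentially. (b - a) / (real N - 1) < \<delta>"
    using \<open>\<delta> > 0\<close> by (rule order_tendstoD)
  then show ?thesis
    \<comment> \<open>\<open>N \<ge> 2\<close> makes \<open>real N - 1\<close> positive, so the step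
      \<open>h\<close> is a genuine mesh width.\<close>
    using eventually_ge_at_top[of 2]
  proof eventually_elim
    case (elim N)
    define h where "h = (b - a) / (real N - 1)"
    have "h \<ge> 0" "h < \<delta>" "(real N - 1) * h = b - a"
      using elim \<open>a < b\<close> by (auto simp: h_def)
    then have node: "a + real n * h \<in> {a..b}" if "n < N" for n
      using that mult_right_mono[of "real n" "real N - 1" h] by auto
    \<comment> \<open>The difference is \<open>h\<close> for positive \<open>n\<close> and 0 for
      \<open>n = 0\<close>.\<close>
    have "\<bar>real n * h - real (n - 1) * h\<bar> < \<delta>" for n
      using \<open>h \<ge> 0\<close> \<open>h < \<delta>\<close> by (cases n) (auto simp: algebra_simps)
    then have "dist (f (a + real n * h)) (f (a + real (n - 1) * h)) < e" if "n < N" for n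
      using that by (intro \<delta> node) (auto simp: dist_real_def)
    then show ?case
      by (force simp: sample_def h_def[symmetric] dist_real_def)
  qed
qed

theorem theorem5:
  fixes p :: nat
  assumes "p \<ge> 1"
  shows
    "(\<exists>c :: nat \<Rightarrow> real.
        \<forall>(a::real) (b::real) (f :: real \<Rightarrow> real). a < b \<longrightarrow> smooth_on {a..b} f \<longrightarrow>
          (\<forall>N n. p < N \<longrightarrow> p \<le> n \<longrightarrow> n \<le> N - 1 \<longrightarrow>
             predictor p (sample a b f N) n = (\<Sum>k=1..p. c k * sample a b f N (n - k))))
     \<and>
     (\<forall>(a::real) (b::real) (f :: real \<Rightarrow> real). a < b \<longrightarrow> smooth_on {a..b} f \<longrightarrow>
        (\<forall>\<epsilon>>0. \<exists>N0>p. \<forall>N\<ge>N0.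
           1 / real N * (\<Sum>n=p..N-1. (sample a b f N n - predictor p (sample a b f N) n)\<^sup>2) \<le> \<epsilon>))"
proof (intro conjI)
  show "\<exists>c :: nat \<Rightarrow> real.
        \<forall>(a::real) (b::real) (f :: real \<Rightarrow> real). a < b \<longrightarrow> smooth_on {a..b} f \<longrightarrow>
          (\<forall>N n. p < N \<longrightarrow> p \<le> n \<longrightarrow> n \<le> N - 1 \<longrightarrow>
             predictor p (sample a b f N) n = (\<Sum>k=1..p. c k * sample a b f N (n - k)))"
    by (intro exI[of _ "\<lambda>k. - ((-1) ^ k * real (p choose k))"] allI impI predictor_linear assms)
next
  show "\<forall>(a::real) (b::real) (f :: real \<Rightarrow> real). a < b \<longrightarrow> smooth_on {a..b} f \<longrightarrow>
        (\<forall>\<epsilon>>0. \<exists>N0>p. \<forall>N\<ge>N0.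
           1 / real N * (\<Sum>n=p..N-1. (sample a b f N n - predictor p (sample a b f N) n)\<^sup>2) \<le> \<epsilon>)"
  proof (intro allI impI)
    fix a b \<epsilon> :: real and f :: "real \<Rightarrow> real"
    assume "a < b" "smooth_on {a..b} f" "\<epsilon> > 0"
    obtain q where q: "p = Suc q"
      using assms by (cases p) auto
    \<comment> \<open>Chosen so that \<open>2 ^ q * e = sqrt \<epsilon>\<close>, which makes every
      single squared error at most \<open>\<epsilon>\<close>.\<close>
    define e where "e = sqrt \<epsilon> / 2 ^ q"
    have "e > 0"
      using \<open>\<epsilon> > 0\<close> by (simp add: e_def)
    then obtain M where M: "\<And>N n. N \<ge> M \<Longrightarrow> n < N \<Longrightarrow>
        \<bar>sample a b f N n - sample a b f N (n - 1)\<bar> \<le> e"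
      using sample_increment_eventually_small[OF \<open>a < b\<close>
          smooth_on_imp_continuous_on[OF \<open>smooth_on {a..b} f\<close>]]
      unfolding eventually_sequentially by blast
    have "1 / real N * (\<Sum>n=p..N-1. (sample a b f N n - predictor p (sample a b f N) n)\<^sup>2) \<le> \<epsilon>"
      if N: "N \<ge> max M (Suc p)" for N
    proof -
      let ?g = "sample a b f N"
      have "(?g n - predictor p ?g n)\<^sup>2 \<le> \<epsilon>" if "n \<in> {p..N-1}" for n
      proof -
        have "\<bar>bdiff p ?g n\<bar> \<le> 2 ^ q * e"
          unfolding q using that N by (intro abs_bdiff_le M) auto
        then have "\<bar>?g n - predictor p ?g n\<bar> \<le> sqrt \<epsilon>"
          by (simp add: prediction_error[OF assms] e_def)
        then show ?thesis
          using \<open>\<epsilon> > 0\<close> sqrt_ge_absD by blast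
      qed
      then have "(\<Sum>n=p..N-1. (?g n - predictor p ?g n)\<^sup>2) \<le> real (card {p..N-1}) * \<epsilon>"
        by (rule sum_bounded_above)
      \<comment> \<open>Since \<open>p \<ge> 1\<close>, the sum has at most \<open>N\<close> terms,
        which the factor \<open>1 / real N\<close> compensates.\<close>
      also have "\<dots> \<le> real N * \<epsilon>"
        using assms \<open>\<epsilon> > 0\<close> by (intro mult_right_mono) auto
      finally show ?thesis
        using N by (simp add: field_simps)
    qed
    then show "\<exists>N0>p. \<forall>N\<ge>N0.
        1 / real N * (\<Sum>n=p..N-1. (sample a b f N n - predictor p (sample a b f N) n)\<^sup>2) \<le> \<epsilon>"
      by (intro exI[of _ "max M (Suc p)"]) auto
  qed
qed

end
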